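(* Let $\Phi$, $j$, $\nu$, $\mathcal J$, $\varphi$, $V$ be as in the standing assumption (see context), and suppose $\varphi\in\mathcal Z_C(\mathbb R^d)\cap L^p(\mathbb R^d)$ for some $C\in(0,1)$ and $p\ge1$, with associated $M_\varphi$, $L_\varphi$. Then for all $x\in B^c_{M_\varphi}(0)$, $$|V(x)|\le\frac12\frac{L_\varphi(x)}{\varphi(x)}\mathcal J(C|x|)+\|\varphi\|_1\frac{j(C|x|)}{\varphi(x)}+\nu(B^c_{C|x|}(0))\quad\text{if }p=1,$$ $$|V(x)|\le\frac12\frac{L_\varphi(x)}{\varphi(x)}\mathcal J(C|x|)+\|\varphi\|_p\frac{\|j\|_{L^q(B^c_{C|x|}(0))}}{\varphi(x)}+\nu(B^c_{C|x|}(0))\quad\text{if }p>1,$$ where $q$ is the Hölder conjugate of $p$. In particular, if $$\lim_{|x|\to\infty}\frac{L_\varphi(x)\mathcal J(C|x|)}{\varphi(x)}=0\ \text{ and }\ \lim_{|x|\to\infty}\frac{j(C|x|)}{\varphi(x)}=0\quad\text{for }p=1,$$ $$\lim_{|x|\to\infty}\frac{L_\varphi(x)\mathcal J(C|x|)}{\varphi(x)}=0\ \text{ and }\ \lim_{|x|\to\infty}\frac{\|j\|_{L^q(B^c_{C|x|}(0))}}{\varphi(x)}=0\quad\text{for }p>1,$$ then $\lim_{|x|\to\infty}V(x)=0$.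
   Context: Notation: $B_r(a)$ is the open ball in $\mathbb R^d$, $B_r^c(a)$ its complement; $D_hf(x)=f(x+h)-2f(x)+f(x-h)$. $\Phi$ is a complete Bernstein function with Lévy pair $(0,\mu)$: $\Phi(u)=\int_0^\infty(1-e^{-ut})\mu(t)\,dt$ with $\mu:(0,\infty)\to[0,\infty)$ completely monotone and $\int_0^\infty\min(1,t)\mu(t)\,dt<\infty$. The jump kernel is $j(r)=(4\pi)^{-d/2}\int_0^\infty t^{-d/2}e^{-r^2/(4t)}\mu(t)\,dt$, $r>0$; $\nu(dx)=j(|x|)\,dx$ on $\mathbb R^d\setminus\{0\}$, and $\mathcal J(R)=\int_{B_R(0)}|h|^2j(|h|)\,dh$. $\|j\|_{L^q(B_R^c(0))}$ denotes the $L^q$-norm of the function $h\mapsto j(|h|)$ on $B_R^c(0)\subset\mathbb R^d$. $\Phi(-\Delta)$ is the operator on $L^2(\mathbb R^d)$ with Fourier multiplier $\Phi(|y|^2)$. Standing assumption: $V:\mathbb R^d\to\mathbb R$ is a potential, $H=\Phi(-\Delta)+V$, and $\varphi\in L^2(\mathbb R^d)\cap L^\infty(\mathbb R^d)$, $\varphi>0$, satisfies $H\varphi=0$. The potential is understood through the pointwise expression $V(x)=-\frac{1}{\varphi(x)}\Phi(-\Delta)\varphi(x)=\frac{1}{2\varphi(x)}\int_{\mathbb R^d}D_h\varphi(x)\,j(|h|)\,dh$. Space: for $C\in(0,1)$, $\mathcal Z_C(\mathbb R^d)$ is the set of $f\in L^\infty(\mathbb R^d)$ for which there exist $M_f>0$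 and $L_f\in L^\infty(B^c_{M_f}(0))$ such that $|D_hf(x)|\le L_f(x)|h|^2$ for all $x\in B^c_{M_f}(0)$ and $h\in B_{C|x|}(0)$. *)

theory Defs
  imports "HOL-Analysis.Analysis"
begin

section \<open>Complete Bernstein functions and jump kernels\<close>

text \<open>Only the values of \<open>\<mu>\<close> on \<open>(0,\<infinity>)\<close> matter: derivatives at \<open>t > 0\<close> are local.\<close>

definition completely_monotone :: "(real \<Rightarrow> real) \<Rightarrow> bool" where
  "completely_monotone \<mu> \<longleftrightarrow>
     (\<forall>n. \<forall>t>0. (deriv ^^ n) \<mu> field_differentiable (at t) \<and> 0 \<le> (-1) ^ n * (deriv ^^ n) \<mu> t)"

definition complete_bernstein_levy :: "(real \<Rightarrow> real) \<Rightarrow> (real \<Rightarrow> real) \<Rightarrow> bool" where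
  "complete_bernstein_levy \<Phi> \<mu> \<longleftrightarrow>
     completely_monotone \<mu> \<and>
     set_integrable lebesgue {0<..} (\<lambda>t. min 1 t * \<mu> t) \<and>
     (\<forall>u>0. \<Phi> u = (LINT t:{0<..}|lebesgue. (1 - exp (- u * t)) * \<mu> t))"

definition jump_kernel :: "nat \<Rightarrow> (real \<Rightarrow> real) \<Rightarrow> real \<Rightarrow> real" where
  "jump_kernel d \<mu> r =
     (4 * pi) powr (- real d / 2) *
     (LINT t:{0<..}|lebesgue. t powr (- real d / 2) * exp (- r\<^sup>2 / (4 * t)) * \<mu> t)"

definition levy_measure :: "(real \<Rightarrow> real) \<Rightarrow> 'a::euclidean_space measure" where
  "levy_measure j = density (lebesgue_on (- {0})) (\<lambda>h. ennreal (j (norm h)))"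

definition truncated_second_moment :: "'a::euclidean_space itself \<Rightarrow> (real \<Rightarrow> real) \<Rightarrow> real \<Rightarrow> real" where
  "truncated_second_moment _ j R = (LINT h:ball (0::'a) R|lebesgue. (norm h)\<^sup>2 * j (norm h))"

section \<open>Lebesgue spaces on subsets of a Euclidean space\<close>

text \<open>Elements are functions, not classes modulo null sets; \<open>Lp_norm\<close> is meaningful only on
  \<open>Lp_on\<close>, for real \<open>0 < p < \<infinity>\<close>.\<close>

definition Lp_on :: "real \<Rightarrow> 'a::euclidean_space set \<Rightarrow> ('a \<Rightarrow> 'b::euclidean_space) set" where
  "Lp_on p S = {f. set_borel_measurable lebesgue S f \<and>
                   set_integrable lebesgue S (\<lambda>x. norm (f x) powr p)}"

definition Lp_norm :: "real \<Rightarrow> 'a::euclidean_space set \<Rightarrow> ('a \<Rightarrow> 'b::euclidean_space) \<Rightarrow> real" where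
  "Lp_norm p S f = (LINT x:S|lebesgue. norm (f x) powr p) powr (1 / p)"

definition Linfty_on :: "'a::euclidean_space set \<Rightarrow> ('a \<Rightarrow> 'b::euclidean_space) set" where
  "Linfty_on S = {f. set_borel_measurable lebesgue S f \<and>
                     (\<exists>K. AE x in lebesgue. x \<in> S \<longrightarrow> norm (f x) \<le> K)}"

section \<open>The operator \<open>\<Phi>(-\<Delta>)\<close> and zero-energy eigenfunctions\<close>

text \<open>\<open>F\<close> is the Fourier--Plancherel transform of \<open>f\<close>: the \<open>L\<^sup>2\<close>-limit of the Fourier integrals
  of the truncations of \<open>f\<close> to balls. The angular-frequency convention makes \<open>-\<Delta>\<close> multiplication
  by \<open>|y|\<^sup>2\<close>. The convergence is stated with the nonnegative integral, which, unlike \<open>Lp_norm\<close>,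
  is not \<open>0\<close> for functions outside \<open>L\<^sup>2\<close>.\<close>

definition L2_fourier :: "('a::euclidean_space \<Rightarrow> complex) \<Rightarrow> ('a \<Rightarrow> complex) \<Rightarrow> bool" where
  "L2_fourier f F \<longleftrightarrow> f \<in> Lp_on 2 UNIV \<and> F \<in> Lp_on 2 UNIV \<and>
     (\<lambda>n. \<integral>\<^sup>+ y. ennreal ((cmod
            (of_real ((2 * pi) powr (- real DIM('a) / 2)) *
             (LINT x:ball 0 (real n)|lebesgue. cis (- (x \<bullet> y)) * f x) - F y))\<^sup>2) \<partial>lebesgue)
       \<longlonglongrightarrow> 0"

text \<open>The graph of \<open>\<Phi>(-\<Delta>)\<close>: \<open>f\<close> is in the domain and is mapped to \<open>g\<close>.\<close>

definition Phi_neg_laplacian :: "(real \<Rightarrow> real) \<Rightarrow> ('a::euclidean_space \<Rightarrow> complex) \<Rightarrow> ('a \<Rightarrow> complex) \<Rightarrow> bool" where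
  "Phi_neg_laplacian \<Phi> f g \<longleftrightarrow>
     (\<exists>F G. L2_fourier f F \<and> L2_fourier g G \<and>
            (AE y in lebesgue. G y = of_real (\<Phi> ((norm y)\<^sup>2)) * F y))"

definition zero_eigenfunction ::
    "(real \<Rightarrow> real) \<Rightarrow> ('a::euclidean_space \<Rightarrow> real) \<Rightarrow> ('a \<Rightarrow> real) \<Rightarrow> bool" where
  "zero_eigenfunction \<Phi> V \<phi> \<longleftrightarrow>
     (\<exists>g. Phi_neg_laplacian \<Phi> (\<lambda>x. of_real (\<phi> x)) g \<and>
          (AE x in lebesgue. g x + of_real (V x * \<phi> x) = 0))"

definition second_diff :: "'a::euclidean_space \<Rightarrow> ('a \<Rightarrow> real) \<Rightarrow> 'a \<Rightarrow> real" where
  "second_diff h f x = f (x + h) - 2 * f x + f (x - h)"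

text \<open>The equation \<open>H\<phi> = 0\<close> in \<open>L\<^sup>2\<close> determines \<open>V\<close> only almost everywhere; the pointwise values
  are fixed by the singular integral. The Bochner integral is \<open>0\<close> by convention for non-integrable
  functions, so nothing is prescribed at points where the singular integral is not absolutely
  convergent.\<close>

definition pointwise_potential ::
    "(real \<Rightarrow> real) \<Rightarrow> ('a::euclidean_space \<Rightarrow> real) \<Rightarrow> ('a \<Rightarrow> real) \<Rightarrow> bool" where
  "pointwise_potential j V \<phi> \<longleftrightarrow>
     (\<forall>x. integrable lebesgue (\<lambda>h. second_diff h \<phi> x * j (norm h)) \<longrightarrow>
          V x = 1 / (2 * \<phi> x) * (LINT h|lebesgue. second_diff h \<phi> x * j (norm h)))"

section \<open>The space \<open>\<Z>\<^sub>C\<close>\<close>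

definition Z_bound ::
    "real \<Rightarrow> ('a::euclidean_space \<Rightarrow> real) \<Rightarrow> real \<Rightarrow> ('a \<Rightarrow> real) \<Rightarrow> bool" where
  "Z_bound C f M L \<longleftrightarrow>
     M > 0 \<and> L \<in> Linfty_on (- ball 0 M) \<and>
     (\<forall>x\<in>- ball 0 M. \<forall>h\<in>ball 0 (C * norm x). \<bar>second_diff h f x\<bar> \<le> L x * (norm h)\<^sup>2)"

definition Z_space :: "real \<Rightarrow> ('a::euclidean_space \<Rightarrow> real) set" where
  "Z_space C = {f \<in> Linfty_on UNIV. \<exists>M L. Z_bound C f M L}"

end

theory Submission
  imports Defs "HOL-Probability.Distributions"
begin

text \<open>The jump kernel \<open>j\<close> is a mixture of Gaussians in the radius. Three of its properties matter: on \<open>(0, \<infinity>)\<close>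
it is nonnegative, it is nonincreasing, and \<open>min 1 (|h|\<^sup>2) * j |h|\<close> is integrable over the space. The last
one follows by Tonelli and the scaling of the Gaussian, which turn it into the integrability of
\<open>min 1 t * \<mu> t\<close> (\<open>nn_integral_min_square_jump_kernel_finite\<close>).

Fix \<open>x\<close> outside the ball of radius \<open>M\<close> and cut the singular integral of \<open>D\<^sub>h \<phi>(x) j |h|\<close> at the
radius \<open>R = C |x|\<close>. On the ball of radius \<open>R\<close> the second difference is at most \<open>L x * |h|\<^sup>2\<close>, which
contributes \<open>L x\<close> times the truncated second moment. Outside, \<open>|D\<^sub>h \<phi>(x)|\<close> is at most
\<open>\<phi>(x + h) + \<phi>(x - h) + 2 \<phi>(x)\<close>. The term \<open>2 \<phi>(x)\<close> contributes the mass of the Levy measure outside the ball.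
Each of the other two is bounded through the invariance of Lebesgue measure under translation and
reflection, either by \<open>\<parallel>\<phi>\<parallel>\<^sub>1 * j R\<close>, since \<open>j\<close> is nonincreasing, or by Hoelder's inequality; the kernel
lies in \<open>L\<^sup>q\<close> outside the ball because it is bounded and integrable there. So the integral
converges absolutely (\<open>second_diff_kernel_bound\<close>), the pointwise formula for \<open>V x\<close> is in force, and division
by \<open>2 \<phi>(x)\<close> gives the bounds (\<open>potential_bound\<close>).

In the limit the first two terms vanish by hypothesis and the third because the Levy measure has finite
mass outside the unit ball (\<open>levy_measure_far_tendsto_0\<close>).\<close>

section \<open>Gaussian moments\<close>

text \<open>This constant is what remains of the heat kernel after rescaling to time one. A factor
\<open>exp (- |h|\<^sup>2 / 8)\<close> absorbs the quadratic weight, and the other one is a product of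
one-dimensional normal densities of variance four, up to a constant.\<close>

lemma nn_integral_max_square_gaussian_finite:
  "(\<integral>\<^sup>+h. ennreal (max 1 ((norm h)\<^sup>2) * exp (- (norm h)\<^sup>2 / 4)) \<partial>(lborel :: 'a::euclidean_space measure)) < \<infinity>"
proof -
  have pw: "max 1 u * exp (- u / 4) \<le> 8 * exp (- u / 8)" if "0 \<le> u" for u :: real
  proof -
    have "max 1 u \<le> 8 * exp (u / 8)"
      using exp_ge_add_one_self[of "u / 8"] that by (simp only: max.bounded_iff) linarith
    then have "max 1 u * exp (- u / 4) \<le> 8 * exp (u / 8) * exp (- u / 4)"
      by (rule mult_right_mono) simp
    also have "\<dots> = 8 * exp (- u / 8)"
      by (simp add: exp_add[symmetric])
    finally show ?thesis .
  qed
  have prod: "exp (- (norm h)\<^sup>2 / 8) = (\<Prod>b\<in>Basis. exp (- (h \<bullet> b)\<^sup>2 / 8))" for h :: 'a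
  proof -
    have "(norm h)\<^sup>2 = (\<Sum>b\<in>Basis. (h \<bullet> b)\<^sup>2)"
      unfolding power2_norm_eq_inner by (subst euclidean_inner) (simp add: power2_eq_square)
    then show ?thesis
      by (simp add: exp_sum[symmetric] sum_negf sum_divide_distrib)
  qed
  have one: "(\<integral>\<^sup>+x. ennreal (exp (- x\<^sup>2 / 8)) \<partial>lborel) < \<infinity>"
  proof -
    have "integrable lborel (\<lambda>x::real. sqrt (2 * pi * 2\<^sup>2) * normal_density 0 2 x)"
      by (intro integrable_mult_right integrable_normal_density) simp
    then have "integrable lborel (\<lambda>x::real. exp (- x\<^sup>2 / 8))"
      by (rule Bochner_Integration.integrable_cong[THEN iffD1, rotated 2])
         (auto simp: normal_density_def)
    then show ?thesis
      by (subst nn_integral_eq_integral) auto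
  qed
  have "(\<integral>\<^sup>+h. ennreal (max 1 ((norm h)\<^sup>2) * exp (- (norm h)\<^sup>2 / 4)) \<partial>(lborel :: 'a measure))
      \<le> (\<integral>\<^sup>+h. ennreal 8 * ennreal (exp (- (norm h)\<^sup>2 / 8)) \<partial>(lborel :: 'a measure))"
    using pw by (intro nn_integral_mono) (simp add: ennreal_mult[symmetric] del: ennreal_numeral)
  also have "\<dots> = ennreal 8 * (\<integral>\<^sup>+h. (\<Prod>b\<in>Basis. ennreal (exp (- (h \<bullet> b)\<^sup>2 / 8))) \<partial>(lborel :: 'a measure))"
    by (subst nn_integral_cmult) (measurable, simp only: prod prod_ennreal exp_ge_zero)
  also have "\<dots> = ennreal 8 * (\<Prod>b\<in>(Basis::'a set). (\<integral>\<^sup>+x. ennreal (exp (- x\<^sup>2 / 8)) \<partial>lborel))"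
    by (subst nn_integral_lborel_prod) auto
  also have "\<dots> < \<infinity>"
    using one by (auto simp: ennreal_mult_less_top power_less_top_ennreal)
  finally show ?thesis .
qed

text \<open>The substitution \<open>h = sqrt t *\<^sub>R y\<close> turns the Gaussian of variance \<open>2 t\<close> per coordinate
into a fixed one, with a Jacobian that cancels \<open>t powr (- d / 2)\<close>, and the weight becomes
\<open>min 1 (t * |y|\<^sup>2) \<le> min 1 t * max 1 (|y|\<^sup>2)\<close>. This is how the truncation
\<open>min 1 (|h|\<^sup>2)\<close> in space corresponds to the truncation \<open>min 1 t\<close> in time.\<close>

lemma nn_integral_min_square_heat_le:
  fixes t :: real
  assumes "0 < t"
  shows "(\<integral>\<^sup>+h. ennreal (min 1 ((norm h)\<^sup>2) * (t powr (- real DIM('a) / 2) * exp (- (norm h)\<^sup>2 / (4 * t))))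
            \<partial>(lborel :: 'a::euclidean_space measure))
       \<le> ennreal (min 1 t) *
         (\<integral>\<^sup>+h. ennreal (max 1 ((norm h)\<^sup>2) * exp (- (norm h)\<^sup>2 / 4)) \<partial>(lborel :: 'a measure))"
proof -
  let ?g = "\<lambda>h::'a. ennreal (min 1 ((norm h)\<^sup>2) * (t powr (- real DIM('a) / 2) * exp (- (norm h)\<^sup>2 / (4 * t))))"
  let ?c = "sqrt t"
  have c: "?c \<noteq> 0" "0 < ?c" using assms by auto
  have jac: "\<bar>?c\<bar> ^ DIM('a) * t powr (- real DIM('a) / 2) = 1"
  proof -
    have "\<bar>?c\<bar> ^ DIM('a) = t powr (real DIM('a) / 2)"
      using assms by (simp add: powr_half_sqrt[symmetric] powr_realpow[symmetric] powr_powr)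
    then show ?thesis using assms by (simp add: powr_add[symmetric])
  qed
  have "(\<integral>\<^sup>+h. ?g h \<partial>lborel) = (\<integral>\<^sup>+y. ennreal (\<bar>?c\<bar> ^ DIM('a)) * ?g (0 + ?c *\<^sub>R y) \<partial>lborel)"
    by (subst lborel_affine[OF c(1), of 0], subst nn_integral_density)
       (auto simp: nn_integral_distr)
  also have "\<dots> \<le> (\<integral>\<^sup>+y. ennreal (min 1 t) * ennreal (max 1 ((norm y)\<^sup>2) * exp (- (norm y)\<^sup>2 / 4)) \<partial>(lborel :: 'a measure))"
  proof (rule nn_integral_mono)
    fix y :: 'a
    have sq: "(norm (?c *\<^sub>R y))\<^sup>2 = t * (norm y)\<^sup>2"
      using assms by (simp add: power_mult_distrib)
    have "min 1 (t * (norm y)\<^sup>2) \<le> min 1 t * max 1 ((norm y)\<^sup>2)"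
    proof (cases "t \<le> 1")
      case True
      have "t * (norm y)\<^sup>2 \<le> t * max 1 ((norm y)\<^sup>2)" using assms by (intro mult_left_mono) auto
      then show ?thesis using True by (simp add: min_def)
    qed (auto simp: min_def max_def)
    then have le: "min 1 (t * (norm y)\<^sup>2) * exp (- (norm y)\<^sup>2 / 4)
        \<le> min 1 t * max 1 ((norm y)\<^sup>2) * exp (- (norm y)\<^sup>2 / 4)"
      by (rule mult_right_mono) simp
    have "\<bar>?c\<bar> ^ DIM('a) * (min 1 (t * (norm y)\<^sup>2) * (t powr (- real DIM('a) / 2) * exp (- (t * (norm y)\<^sup>2) / (4 * t))))
       = (\<bar>?c\<bar> ^ DIM('a) * t powr (- real DIM('a) / 2)) * (min 1 (t * (norm y)\<^sup>2) * exp (- (norm y)\<^sup>2 / 4))"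
      using assms by simp
    also have "\<dots> = min 1 (t * (norm y)\<^sup>2) * exp (- (norm y)\<^sup>2 / 4)"
      unfolding jac by simp
    finally have eq: "\<bar>?c\<bar> ^ DIM('a) * (min 1 (t * (norm y)\<^sup>2) * (t powr (- real DIM('a) / 2) * exp (- (t * (norm y)\<^sup>2) / (4 * t))))
       = min 1 (t * (norm y)\<^sup>2) * exp (- (norm y)\<^sup>2 / 4)" .
    show "ennreal (\<bar>?c\<bar> ^ DIM('a)) * ?g (0 + ?c *\<^sub>R y)
        \<le> ennreal (min 1 t) * ennreal (max 1 ((norm y)\<^sup>2) * exp (- (norm y)\<^sup>2 / 4))"
      unfolding add_0 sq using assms le
      by (subst (1 2) ennreal_mult[symmetric]) (simp_all only: eq mult.assoc ennreal_leI, auto)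
  qed
  also have "\<dots> = ennreal (min 1 t) *
         (\<integral>\<^sup>+h. ennreal (max 1 ((norm h)\<^sup>2) * exp (- (norm h)\<^sup>2 / 4)) \<partial>(lborel :: 'a measure))"
    by (rule nn_integral_cmult) auto
  finally show ?thesis .
qed

text \<open>Away from the origin of space the heat kernel vanishes at \<open>t = 0\<close> faster than every power of \<open>t\<close>,
so the integrability of \<open>min 1 t * \<mu> t\<close> makes the integral that defines the jump kernel
converge.\<close>

lemma heat_profile_le_min:
  fixes r :: real
  assumes "0 < r"
  obtains K where "0 \<le> K"
    and "\<And>t. 0 < t \<Longrightarrow> t powr (- real d / 2) * exp (- r\<^sup>2 / (4 * t)) \<le> K * min 1 t"
proof
  \<comment> \<open>\<open>exp y \<ge> (y / n) ^ n\<close> gains a factor \<open>t ^ n\<close>; \<open>n \<ge> d / 2 + 1\<close> leaves one power of \<open>t\<close>.\<close>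
  define n where "n = Suc d"
  define K where "K = max 1 ((4 * real n / r\<^sup>2) ^ n)"
  show "0 \<le> K" by (simp add: K_def)
  fix t :: real
  assume t: "0 < t"
  show "t powr (- real d / 2) * exp (- r\<^sup>2 / (4 * t)) \<le> K * min 1 t"
  proof (cases "1 \<le> t")
    case True
    have "t powr (- real d / 2) \<le> t powr 0"
      using True by (intro powr_mono) auto
    then have "t powr (- real d / 2) * exp (- r\<^sup>2 / (4 * t)) \<le> 1 * 1"
      using t by (intro mult_mono) auto
    also have "\<dots> \<le> K * min 1 t" using True by (simp add: K_def)
    finally show ?thesis .
  next
    case False
    define y where "y = r\<^sup>2 / (4 * t)"
    have y: "0 < y" using assms t by (simp add: y_def)
    have "(y / n) ^ n \<le> exp (y / n) ^ n"
      using y exp_ge_add_one_self[of "y / n"] by (intro power_mono) (linarith | simp)+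
    also have "\<dots> = exp y" by (subst exp_of_nat_mult[symmetric]) (simp add: n_def)
    finally have le: "(y / n) ^ n \<le> exp y" .
    have "0 < (y / n) ^ n" using y by (intro zero_less_power divide_pos_pos) (simp_all add: n_def)
    with le have "inverse (exp y) \<le> inverse ((y / n) ^ n)"
      by (rule le_imp_inverse_le)
    then have "exp (- y) \<le> inverse ((y / n) ^ n)"
      by (simp only: exp_minus)
    also have "\<dots> = (4 * real n / r\<^sup>2) ^ n * t ^ n"
    proof -
      have "real n / y = 4 * real n / r\<^sup>2 * t" by (simp add: y_def)
      then show ?thesis
        by (simp only: power_inverse[symmetric] inverse_divide power_mult_distrib)
    qed
    finally have e: "exp (- y) \<le> (4 * real n / r\<^sup>2) ^ n * t ^ n" .
    have "t powr (- real d / 2) * exp (- y) \<le> t powr (- real d / 2) * ((4 * real n / r\<^sup>2) ^ n * t ^ n)"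
      by (intro mult_left_mono e) simp
    also have "\<dots> = (4 * real n / r\<^sup>2) ^ n * t powr (real n - real d / 2)"
      using t by (simp add: powr_realpow[symmetric] powr_add[symmetric] del: power_Suc)
    also have "\<dots> \<le> (4 * real n / r\<^sup>2) ^ n * t powr 1"
      using t False by (intro mult_left_mono powr_mono') (auto simp: n_def)
    also have "\<dots> \<le> K * min 1 t"
      using t False by (auto simp: K_def intro!: mult_right_mono)
    finally show ?thesis by (simp add: y_def)
  qed
qed

section \<open>From the density \<open>\<mu>\<close> to the jump kernel\<close>

locale levy_density =
  fixes \<mu> :: "real \<Rightarrow> real"
  assumes continuous: "continuous_on {0<..} \<mu>"
    and nonneg: "\<And>t. 0 < t \<Longrightarrow> 0 \<le> \<mu> t"
    and integrable_min: "set_integrable lebesgue {0<..} (\<lambda>t. min 1 t * \<mu> t)"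
begin

lemma borel_measurable_density [measurable]: "(\<lambda>t. indicator {0<..} t * \<mu> t) \<in> borel_measurable borel"
  using borel_measurable_continuous_on_indicator[OF _ continuous] by simp

lemma set_integrable_subordination:
  assumes "0 < r"
  shows "set_integrable lebesgue {0<..} (\<lambda>t. t powr (- real d / 2) * exp (- r\<^sup>2 / (4 * t)) * \<mu> t)"
proof -
  obtain K where K: "0 \<le> K"
    "\<And>t. 0 < t \<Longrightarrow> t powr (- real d / 2) * exp (- r\<^sup>2 / (4 * t)) \<le> K * min 1 t"
    using heat_profile_le_min[OF assms, of d] by blast
  have m: "(\<lambda>t. t powr (- real d / 2) * exp (- r\<^sup>2 / (4 * t)) * (indicator {0<..} t * \<mu> t))
      \<in> borel_measurable lebesgue"
    by (rule measurable_completion) measurable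
  have "integrable lebesgue (\<lambda>t. K * (indicator {0<..} t *\<^sub>R (min 1 t * \<mu> t)))"
    using integrable_min unfolding set_integrable_def by (rule integrable_mult_right)
  then have "integrable lebesgue (\<lambda>t. t powr (- real d / 2) * exp (- r\<^sup>2 / (4 * t)) * (indicator {0<..} t * \<mu> t))"
  proof (rule Bochner_Integration.integrable_bound[OF _ m], intro AE_I2)
    fix t :: real
    show "norm (t powr (- real d / 2) * exp (- r\<^sup>2 / (4 * t)) * (indicator {0<..} t * \<mu> t))
        \<le> norm (K * (indicator {0<..} t *\<^sub>R (min 1 t * \<mu> t)))"
    proof (cases "0 < t")
      case True
      then show ?thesis
        using K(1) mult_right_mono[OF K(2)[OF True] nonneg[OF True]] nonneg[OF True]
        by (simp add: abs_mult mult.assoc)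
    qed simp
  qed
  then show ?thesis
    unfolding set_integrable_def by (simp add: ac_simps)
qed

lemma jump_kernel_nonneg: "0 \<le> jump_kernel d \<mu> r"
  unfolding jump_kernel_def set_lebesgue_integral_def
  using nonneg by (intro mult_nonneg_nonneg integral_nonneg) (auto simp: indicator_def)

lemma jump_kernel_antimono:
  assumes "0 < r" "r \<le> s"
  shows "jump_kernel d \<mu> s \<le> jump_kernel d \<mu> r"
  unfolding jump_kernel_def
proof (intro mult_left_mono set_integral_mono set_integrable_subordination)
  fix t :: real assume "t \<in> {0<..}"
  moreover have "r\<^sup>2 \<le> s\<^sup>2" using assms by (intro power_mono) auto
  ultimately show "t powr (- real d / 2) * exp (- s\<^sup>2 / (4 * t)) * \<mu> t
      \<le> t powr (- real d / 2) * exp (- r\<^sup>2 / (4 * t)) * \<mu> t"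
    using nonneg[of t] by (intro mult_right_mono mult_left_mono) (auto simp: divide_right_mono)
qed (use assms in auto)

text \<open>The nonnegative form of the subordination integral: it is needed to exchange the order of
integration in \<open>h\<close> and \<open>t\<close> before anything is known to be integrable in \<open>h\<close>.\<close>

lemma ennreal_jump_kernel:
  assumes "0 < r"
  shows "ennreal (jump_kernel d \<mu> r) = ennreal ((4 * pi) powr (- real d / 2)) *
     (\<integral>\<^sup>+t. ennreal (t powr (- real d / 2) * exp (- r\<^sup>2 / (4 * t)) * (indicator {0<..} t * \<mu> t)) \<partial>lborel)"
proof -
  let ?f = "\<lambda>t. t powr (- real d / 2) * exp (- r\<^sup>2 / (4 * t)) * (indicator {0<..} t * \<mu> t)"
  have "integrable lebesgue ?f"
    using set_integrable_subordination[OF assms, of d] unfolding set_integrable_def by (simp add: ac_simps)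
  moreover have "?f \<in> borel_measurable lborel" by measurable
  ultimately have int: "integrable lborel ?f"
    by (simp add: integrable_completion)
  have pos: "0 \<le> ?f t" for t using nonneg[of t] by (simp add: indicator_def)
  have "(LINT t:{0<..}|lebesgue. t powr (- real d / 2) * exp (- r\<^sup>2 / (4 * t)) * \<mu> t) = integral\<^sup>L lebesgue ?f"
    unfolding set_lebesgue_integral_def by (simp add: ac_simps)
  also have "\<dots> = integral\<^sup>L lborel ?f"
    by (rule integral_completion) measurable
  finally show ?thesis
    unfolding jump_kernel_def using pos int
    by (simp add: nn_integral_eq_integral ennreal_mult integral_nonneg)
qed

text \<open>By Tonelli the integral over \<open>h\<close> can be done first for fixed \<open>t\<close>, where
\<open>nn_integral_min_square_heat_le\<close> bounds it by a constant times \<open>min 1 t\<close>; the remaining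
integral in \<open>t\<close> is the integrability condition on \<open>\<mu>\<close>.\<close>

lemma nn_integral_min_square_jump_kernel_finite:
  "(\<integral>\<^sup>+h. ennreal (min 1 ((norm h)\<^sup>2) * jump_kernel DIM('a) \<mu> (norm h)) \<partial>(lborel :: 'a::euclidean_space measure)) < \<infinity>"
proof -
  let ?d = "real DIM('a)"
  let ?c = "(4 * pi) powr (- ?d / 2)"
  let ?m = "\<lambda>t. indicator {0<..} t * \<mu> t"
  let ?w = "\<lambda>h::'a. \<lambda>t. min 1 ((norm h)\<^sup>2) * (t powr (- ?d / 2) * exp (- (norm h)\<^sup>2 / (4 * t)))"
  let ?K = "\<integral>\<^sup>+h. ennreal (max 1 ((norm h)\<^sup>2) * exp (- (norm h)\<^sup>2 / 4)) \<partial>(lborel :: 'a measure)"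
  have m0: "0 \<le> ?m t" for t using nonneg[of t] by (simp add: indicator_def)
  have "ennreal (min 1 ((norm h)\<^sup>2) * jump_kernel DIM('a) \<mu> (norm h))
      = ennreal ?c * (\<integral>\<^sup>+t. ennreal (?w h t) * ennreal (?m t) \<partial>lborel)" for h :: 'a
  proof (cases "h = 0")
    case False
    have "ennreal (min 1 ((norm h)\<^sup>2) * jump_kernel DIM('a) \<mu> (norm h))
      = ennreal (min 1 ((norm h)\<^sup>2)) * (ennreal ?c *
         (\<integral>\<^sup>+t. ennreal (t powr (- ?d / 2) * exp (- (norm h)\<^sup>2 / (4 * t)) * ?m t) \<partial>lborel))"
      using False jump_kernel_nonneg by (subst ennreal_mult) (auto simp: ennreal_jump_kernel)
    also have "\<dots> = ennreal ?c * (\<integral>\<^sup>+t. ennreal (min 1 ((norm h)\<^sup>2)) *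
          ennreal (t powr (- ?d / 2) * exp (- (norm h)\<^sup>2 / (4 * t)) * ?m t) \<partial>lborel)"
      by (subst nn_integral_cmult) (measurable, simp only: ac_simps)
    also have "\<dots> = ennreal ?c * (\<integral>\<^sup>+t. ennreal (?w h t) * ennreal (?m t) \<partial>lborel)"
      using m0 by (simp add: ennreal_mult[symmetric] mult.assoc)
    finally show ?thesis .
  qed simp
  then have "(\<integral>\<^sup>+h. ennreal (min 1 ((norm h)\<^sup>2) * jump_kernel DIM('a) \<mu> (norm h)) \<partial>(lborel :: 'a measure))
     = (\<integral>\<^sup>+h. ennreal ?c * (\<integral>\<^sup>+t. ennreal (?w h t) * ennreal (?m t) \<partial>lborel) \<partial>lborel)"
    by (simp only:)
  also have "\<dots> = ennreal ?c * (\<integral>\<^sup>+h. (\<integral>\<^sup>+t. ennreal (?w h t) * ennreal (?m t) \<partial>lborel) \<partial>lborel)"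
    by (rule nn_integral_cmult) measurable
  finally have total: "(\<integral>\<^sup>+h. ennreal (min 1 ((norm h)\<^sup>2) * jump_kernel DIM('a) \<mu> (norm h)) \<partial>(lborel :: 'a measure))
     = ennreal ?c * (\<integral>\<^sup>+h. (\<integral>\<^sup>+t. ennreal (?w h t) * ennreal (?m t) \<partial>lborel) \<partial>lborel)" .
  have "(\<integral>\<^sup>+h. (\<integral>\<^sup>+t. ennreal (?w h t) * ennreal (?m t) \<partial>lborel) \<partial>lborel)
      = (\<integral>\<^sup>+t. (\<integral>\<^sup>+h. ennreal (?w h t) * ennreal (?m t) \<partial>lborel) \<partial>lborel)"
    by (rule lborel_pair.Fubini'[symmetric]) measurable
  also have "\<dots> = (\<integral>\<^sup>+t. (\<integral>\<^sup>+h. ennreal (?w h t) \<partial>lborel) * ennreal (?m t) \<partial>lborel)"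
    by (intro nn_integral_cong nn_integral_multc) measurable
  also have "\<dots> \<le> (\<integral>\<^sup>+t. ?K * ennreal (min 1 t * ?m t) \<partial>lborel)"
  proof (rule nn_integral_mono)
    fix t :: real
    show "(\<integral>\<^sup>+h. ennreal (?w h t) \<partial>lborel) * ennreal (?m t) \<le> ?K * ennreal (min 1 t * ?m t)"
    proof (cases "0 < t")
      case True
      have "(\<integral>\<^sup>+h. ennreal (?w h t) \<partial>lborel) * ennreal (?m t) \<le> (ennreal (min 1 t) * ?K) * ennreal (?m t)"
        by (intro mult_right_mono nn_integral_min_square_heat_le True) simp
      also have "\<dots> = ?K * ennreal (min 1 t * ?m t)"
        using True nonneg[OF True] by (simp add: ennreal_mult ac_simps)
      finally show ?thesis .
    qed simp
  qed
  also have "\<dots> = ?K * (\<integral>\<^sup>+t. ennreal (min 1 t * ?m t) \<partial>lborel)"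
    by (rule nn_integral_cmult) measurable
  finally have le: "(\<integral>\<^sup>+h. ennreal (min 1 ((norm h)\<^sup>2) * jump_kernel DIM('a) \<mu> (norm h)) \<partial>(lborel :: 'a measure))
      \<le> ennreal ?c * (?K * (\<integral>\<^sup>+t. ennreal (min 1 t * ?m t) \<partial>lborel))"
    unfolding total by (rule mult_left_mono) simp
  have "integrable lebesgue (\<lambda>t. min 1 t * ?m t)"
    using integrable_min unfolding set_integrable_def by (simp add: ac_simps)
  then have "integrable lborel (\<lambda>t. min 1 t * ?m t)"
    by (subst (asm) integrable_completion) measurable
  then have "(\<integral>\<^sup>+t. ennreal (min 1 t * ?m t) \<partial>lborel) < \<infinity>"
    using nonneg by (subst nn_integral_eq_integral) (auto simp: indicator_def)
  then show ?thesis
    using nn_integral_max_square_gaussian_finite[where 'a='a]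
    by (intro le_less_trans[OF le]) (auto simp: ennreal_mult_less_top)
qed

end

section \<open>Tools from integration theory\<close>

text \<open>Young's inequality applied to \<open>f / \<parallel>f\<parallel>\<close> and \<open>g / \<parallel>g\<parallel>\<close>, integrated. If one of the norms vanishes,
the product is zero almost everywhere.\<close>

lemma Holder_inequality:
  fixes f g :: "'a \<Rightarrow> real"
  assumes pq: "p > 1" "q > 1" "1 / p + 1 / q = 1"
    and f [measurable]: "f \<in> borel_measurable M" and g [measurable]: "g \<in> borel_measurable M"
    and f0: "\<And>x. 0 \<le> f x" and g0: "\<And>x. 0 \<le> g x"
    and fp: "integrable M (\<lambda>x. f x powr p)" and gq: "integrable M (\<lambda>x. g x powr q)"
  shows "integrable M (\<lambda>x. f x * g x)"
    and "(LINT x|M. f x * g x) \<le> (LINT x|M. f x powr p) powr (1 / p) * (LINT x|M. g x powr q) powr (1 / q)"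
proof -
  have young: "f x * g x \<le> f x powr p / p + g x powr q / q" for x
    using Youngs_inequality[OF pq f0 g0] .
  show int: "integrable M (\<lambda>x. f x * g x)"
  proof (rule Bochner_Integration.integrable_bound)
    show "integrable M (\<lambda>x. f x powr p / p + g x powr q / q)"
      using fp gq by (intro Bochner_Integration.integrable_add integrable_divide)
    show "AE x in M. norm (f x * g x) \<le> norm (f x powr p / p + g x powr q / q)"
    proof (rule AE_I2)
      fix x
      show "norm (f x * g x) \<le> norm (f x powr p / p + g x powr q / q)"
        using young[of x] f0[of x] g0[of x] by (simp add: abs_mult)
    qed
  qed measurable
  let ?A = "(LINT x|M. f x powr p) powr (1 / p)" and ?B = "(LINT x|M. g x powr q) powr (1 / q)"
  have Ap: "?A powr p = (LINT x|M. f x powr p)" and Bq: "?B powr q = (LINT x|M. g x powr q)"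
    using pq by (simp_all add: powr_powr integral_nonneg)
  show "(LINT x|M. f x * g x) \<le> ?A * ?B"
  proof (cases "(LINT x|M. f x powr p) = 0 \<or> (LINT x|M. g x powr q) = 0")
    case True
    then have "(AE x in M. f x powr p = 0) \<or> (AE x in M. g x powr q = 0)"
      using integral_nonneg_eq_0_iff_AE[OF fp] integral_nonneg_eq_0_iff_AE[OF gq] by auto
    then have "AE x in M. f x * g x = 0" by (auto elim!: AE_mp)
    then have "(LINT x|M. f x * g x) = 0" by (rule integral_eq_zero_AE)
    then show ?thesis by simp
  next
    case False
    moreover have "0 \<le> (LINT x|M. f x powr p)" "0 \<le> (LINT x|M. g x powr q)"
      by (simp_all add: integral_nonneg)
    ultimately have pos: "0 < ?A" "0 < ?B" by auto
    have "(LINT x|M. f x / ?A * (g x / ?B)) \<le> (LINT x|M. (f x powr p / ?A powr p) / p + (g x powr q / ?B powr q) / q)"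
    proof (rule integral_mono)
      show "integrable M (\<lambda>x. f x / ?A * (g x / ?B))"
        using integrable_divide[OF int, of "?A * ?B"] by simp
      show "integrable M (\<lambda>x. (f x powr p / ?A powr p) / p + (g x powr q / ?B powr q) / q)"
        using fp gq by (intro Bochner_Integration.integrable_add integrable_divide)
      fix x
      show "f x / ?A * (g x / ?B) \<le> (f x powr p / ?A powr p) / p + (g x powr q / ?B powr q) / q"
        using Youngs_inequality[OF pq, of "f x / ?A" "g x / ?B"] f0[of x] g0[of x] pos
        by (simp add: powr_divide)
    qed
    also have "\<dots> = (LINT x|M. (f x powr p / ?A powr p) / p) + (LINT x|M. (g x powr q / ?B powr q) / q)"
      using fp gq by (intro Bochner_Integration.integral_add integrable_divide)
    also have "\<dots> = 1 / p + 1 / q"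
      unfolding Ap Bq using False by simp
    finally have "(LINT x|M. f x * g x) / (?A * ?B) \<le> 1"
      using pq by simp
    then show ?thesis using pos by (simp add: divide_le_eq)
  qed
qed

text \<open>The case \<open>s = - 1\<close> is used for the term \<open>\<phi> (x - h)\<close> of the second difference.\<close>

lemma lebesgue_eq_distr_isometry:
  fixes x :: "'a::euclidean_space"
  assumes "\<bar>s\<bar> = 1"
  shows "lebesgue = distr lebesgue lebesgue (\<lambda>h. x + s *\<^sub>R h)"
    and "(\<lambda>h. x + s *\<^sub>R h) \<in> lebesgue \<rightarrow>\<^sub>M lebesgue"
proof -
  have eq: "(\<lambda>h. x + (\<Sum>b\<in>Basis. (s * (h \<bullet> b)) *\<^sub>R b)) = (\<lambda>h. x + s *\<^sub>R h)"
    by (simp add: scaleR_scaleR[symmetric] scaleR_sum_right[symmetric] euclidean_representation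
        del: scaleR_scaleR)
  have s: "s \<noteq> 0" using assms by auto
  show "(\<lambda>h. x + s *\<^sub>R h) \<in> lebesgue \<rightarrow>\<^sub>M lebesgue"
    using lebesgue_affine_measurable[of "\<lambda>_. s" x] s unfolding eq by simp
  show "lebesgue = distr lebesgue lebesgue (\<lambda>h. x + s *\<^sub>R h)"
    using lebesgue_affine_euclidean[of "\<lambda>_. s" x] s assms unfolding eq by (simp add: density_1)
qed

lemma lebesgue_isometry:
  fixes x :: "'a::euclidean_space" and f :: "'a \<Rightarrow> real"
  assumes s: "\<bar>s\<bar> = 1" and f: "f \<in> borel_measurable lebesgue"
  shows "(\<lambda>h. f (x + s *\<^sub>R h)) \<in> borel_measurable lebesgue"
    and "integrable lebesgue (\<lambda>h. f (x + s *\<^sub>R h)) \<longleftrightarrow> integrable lebesgue f"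
    and "(LINT h|lebesgue. f (x + s *\<^sub>R h)) = (LINT h|lebesgue. f h)"
proof -
  note T = lebesgue_eq_distr_isometry[OF s, of x]
  show "(\<lambda>h. f (x + s *\<^sub>R h)) \<in> borel_measurable lebesgue"
    using measurable_compose[OF T(2) f] .
  show "integrable lebesgue (\<lambda>h. f (x + s *\<^sub>R h)) \<longleftrightarrow> integrable lebesgue f"
    using integrable_distr_eq[OF T(2) f] T(1) by simp
  show "(LINT h|lebesgue. f (x + s *\<^sub>R h)) = (LINT h|lebesgue. f h)"
    using integral_distr[OF T(2) f] T(1) by simp
qed

section \<open>Radial Levy kernels\<close>

text \<open>The space enters as an explicit argument, since the kernel is a function on the reals and its type
does not determine the dimension.\<close>

definition levy_moment :: "'a::euclidean_space itself \<Rightarrow> (real \<Rightarrow> real) \<Rightarrow> ennreal" where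
  "levy_moment _ j = (\<integral>\<^sup>+h. ennreal (min 1 ((norm h)\<^sup>2) * j (norm h)) \<partial>(lborel :: 'a measure))"

text \<open>The three properties of the jump kernel on which the estimate rests. The integral
against \<open>min 1 (|h|\<^sup>2)\<close> limits the singularity at the origin and the total mass at infinity, and
monotonicity makes the kernel bounded away from the origin.\<close>

locale radial_levy_kernel =
  fixes j :: "real \<Rightarrow> real" and E :: "'a::euclidean_space itself"
  assumes nonneg: "\<And>r. 0 < r \<Longrightarrow> 0 \<le> j r"
    and antimono: "\<And>r s. 0 < r \<Longrightarrow> r \<le> s \<Longrightarrow> j s \<le> j r"
    and levy: "levy_moment E j < \<infinity>"
begin

lemma borel_measurable_kernel [measurable]: "(\<lambda>h::'a. j (norm h)) \<in> borel_measurable borel"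
proof -
  have "mono_on {0<..} (\<lambda>r. - j r)"
    using antimono by (auto intro!: mono_onI)
  then have "(\<lambda>r. - j r) \<in> borel_measurable (restrict_space borel {0<..})"
    by (rule borel_measurable_mono_on_fnc)
  then have "(\<lambda>r. indicator {0<..} r *\<^sub>R (- j r)) \<in> borel_measurable borel"
    by (subst (asm) borel_measurable_restrict_space_iff) auto
  then have [measurable]: "(\<lambda>r. indicator {0<..} r *\<^sub>R (- j r)) \<in> borel_measurable borel" .
  have "(\<lambda>h::'a. if h = 0 then j 0 else - (indicator {0<..} (norm h) *\<^sub>R (- j (norm h)))) \<in> borel_measurable borel"
    by measurable
  also have "(\<lambda>h::'a. if h = 0 then j 0 else - (indicator {0<..} (norm h) *\<^sub>R (- j (norm h)))) = (\<lambda>h. j (norm h))"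
    by auto
  finally show ?thesis .
qed

lemma borel_measurable_lebesgue_kernel [measurable]: "(\<lambda>h::'a. j (norm h)) \<in> borel_measurable lebesgue"
  by (rule measurable_completion) measurable

lemma min_square_kernel_nonneg: "0 \<le> min 1 ((norm h)\<^sup>2) * j (norm (h::'a))"
  by (cases "h = 0") (auto intro!: mult_nonneg_nonneg nonneg)

lemma far_kernel_nonneg: "0 < R \<Longrightarrow> 0 \<le> indicator (- ball 0 R) h * j (norm (h::'a))"
  by (cases "h = 0") (auto simp: indicator_def intro!: nonneg)

lemma integrable_min_square: "integrable lebesgue (\<lambda>h::'a. min 1 ((norm h)\<^sup>2) * j (norm h))"
proof -
  have "integrable lborel (\<lambda>h::'a. min 1 ((norm h)\<^sup>2) * j (norm h))"
    using levy[unfolded levy_moment_def] min_square_kernel_nonneg by (intro integrableI_nonneg) auto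
  then show ?thesis by (subst integrable_completion) measurable
qed

lemma integrable_near:
  "set_integrable lebesgue (ball (0::'a) R) (\<lambda>h. (norm h)\<^sup>2 * j (norm h))"
  unfolding set_integrable_def
proof (rule Bochner_Integration.integrable_bound)
  show "integrable lebesgue (\<lambda>h::'a. max 1 (R\<^sup>2) * (min 1 ((norm h)\<^sup>2) * j (norm h)))"
    using integrable_min_square by (rule integrable_mult_right)
  have [measurable]: "ball (0::'a) R \<in> sets borel" by simp
  show "(\<lambda>h::'a. indicator (ball 0 R) h *\<^sub>R ((norm h)\<^sup>2 * j (norm h))) \<in> borel_measurable lebesgue"
    by (rule measurable_completion) measurable
  show "AE h::'a in lebesgue. norm (indicator (ball 0 R) h *\<^sub>R ((norm h)\<^sup>2 * j (norm h)))
        \<le> norm (max 1 (R\<^sup>2) * (min 1 ((norm h)\<^sup>2) * j (norm h)))"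
  proof (rule AE_I2)
    fix h :: 'a
    show "norm (indicator (ball 0 R) h *\<^sub>R ((norm h)\<^sup>2 * j (norm h)))
        \<le> norm (max 1 (R\<^sup>2) * (min 1 ((norm h)\<^sup>2) * j (norm h)))"
    proof (cases "h \<in> ball 0 R \<and> h \<noteq> 0")
      case True
      then have "(norm h)\<^sup>2 \<le> R\<^sup>2" by (intro power_mono) auto
      then have "(norm h)\<^sup>2 \<le> max 1 (R\<^sup>2) * min 1 ((norm h)\<^sup>2)"
        using mult_right_mono[of 1 "max 1 (R\<^sup>2)" "(norm h)\<^sup>2"]
        by (subst min_mult_distrib_left) (auto simp: max.coboundedI2)
      then have "(norm h)\<^sup>2 * j (norm h) \<le> max 1 (R\<^sup>2) * min 1 ((norm h)\<^sup>2) * j (norm h)"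
        using True by (intro mult_right_mono nonneg) auto
      then show ?thesis using True nonneg[of "norm h"] by (simp add: abs_mult mult.assoc)
    qed auto
  qed
qed

lemma integrable_far:
  assumes "0 < R"
  shows "set_integrable lebesgue (- ball (0::'a) R) (\<lambda>h. j (norm h))"
  unfolding set_integrable_def
proof (rule Bochner_Integration.integrable_bound)
  show "integrable lebesgue (\<lambda>h::'a. max 1 (1 / R\<^sup>2) * (min 1 ((norm h)\<^sup>2) * j (norm h)))"
    using integrable_min_square by (rule integrable_mult_right)
  show "(\<lambda>h::'a. indicator (- ball 0 R) h *\<^sub>R j (norm h)) \<in> borel_measurable lebesgue"
    by (rule measurable_completion) measurable
  show "AE h::'a in lebesgue. norm (indicator (- ball 0 R) h *\<^sub>R j (norm h))
        \<le> norm (max 1 (1 / R\<^sup>2) * (min 1 ((norm h)\<^sup>2) * j (norm h)))"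
  proof (rule AE_I2)
    fix h :: 'a
    show "norm (indicator (- ball 0 R) h *\<^sub>R j (norm h))
        \<le> norm (max 1 (1 / R\<^sup>2) * (min 1 ((norm h)\<^sup>2) * j (norm h)))"
    proof (cases "h \<in> - ball 0 R")
      case True
      then have h: "R \<le> norm h" "0 < norm h" using assms by auto
      then have "R\<^sup>2 \<le> (norm h)\<^sup>2" using assms by (intro power_mono) auto
      then have "1 \<le> 1 / R\<^sup>2 * (norm h)\<^sup>2" using assms by (simp add: field_simps)
      also have "\<dots> \<le> max 1 (1 / R\<^sup>2) * (norm h)\<^sup>2" by (intro mult_right_mono) auto
      finally have "1 \<le> max 1 (1 / R\<^sup>2) * min 1 ((norm h)\<^sup>2)"
        by (subst min_mult_distrib_left) auto
      then have "1 * j (norm h) \<le> max 1 (1 / R\<^sup>2) * min 1 ((norm h)\<^sup>2) * j (norm h)"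
        using h by (intro mult_right_mono nonneg) auto
      then show ?thesis using True nonneg[of "norm h"] h(2) by (simp add: abs_mult mult.assoc)
    qed auto
  qed
qed

text \<open>The measure returns \<open>0\<close> on sets of infinite mass, so this identity rests on the
integrability of the kernel away from the origin.\<close>

lemma measure_levy_measure_far:
  assumes "0 < R"
  shows "measure (levy_measure j) (- ball (0::'a) R) = (LINT h:- ball (0::'a) R|lebesgue. j (norm h))"
proof -
  have nn: "0 \<le> indicator (- ball 0 R) h *\<^sub>R j (norm h)" for h :: 'a
    using far_kernel_nonneg[OF assms] by simp
  have S: "- {0::'a} \<in> sets lebesgue" "- ball (0::'a) R \<in> sets lebesgue" by auto
  have sub: "- ball (0::'a) R \<subseteq> - {0}" using assms by auto
  have "emeasure (levy_measure j) (- ball (0::'a) R)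
      = (\<integral>\<^sup>+h. ennreal (j (norm h)) * indicator (- ball 0 R) h \<partial>lebesgue_on (- {0::'a}))"
    unfolding levy_measure_def
    by (rule emeasure_density)
      (use S sub in \<open>auto simp: sets_restrict_space_iff intro!: measurable_restrict_space1 borel_measurable_lebesgue_kernel\<close>)
  also have "\<dots> = (\<integral>\<^sup>+h. ennreal (j (norm h)) * indicator (- ball 0 R) h * indicator (- {0::'a}) h \<partial>lebesgue)"
    by (rule nn_integral_restrict_space) simp
  also have "\<dots> = (\<integral>\<^sup>+h. ennreal (indicator (- ball (0::'a) R) h *\<^sub>R j (norm h)) \<partial>lebesgue)"
    using sub by (intro nn_integral_cong) (auto simp: indicator_def)
  also have "\<dots> = ennreal (LINT h:- ball (0::'a) R|lebesgue. j (norm h))"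
    unfolding set_lebesgue_integral_def
    using integrable_far[OF assms] nn unfolding set_integrable_def
    by (intro nn_integral_eq_integral) auto
  finally show ?thesis
    using nn by (simp add: measure_def set_lebesgue_integral_def integral_nonneg)
qed

lemma levy_measure_far_tendsto_0:
  "((\<lambda>R. measure (levy_measure j) (- ball (0::'a) R)) \<longlongrightarrow> 0) at_top"
proof -
  let ?s = "\<lambda>R. \<lambda>h::'a. indicator (- ball 0 R) h *\<^sub>R j (norm h)"
  have m: "?s R \<in> borel_measurable lebesgue" for R
    by (rule measurable_completion) measurable
  have "((\<lambda>R. integral\<^sup>L lebesgue (?s R)) \<longlongrightarrow> integral\<^sup>L lebesgue (\<lambda>h::'a. 0::real)) at_top"
  proof (rule integral_dominated_convergence_at_top[where w = "?s 1"])
    show "integrable lebesgue (?s 1)"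
      using integrable_far[of 1] by (simp add: set_integrable_def)
    show "AE h in lebesgue. ((\<lambda>R. ?s R h) \<longlongrightarrow> 0) at_top"
    proof (rule AE_I2)
      fix h :: 'a
      have "\<forall>\<^sub>F R in at_top. ?s R h = 0"
        using eventually_gt_at_top[of "norm h"] by eventually_elim auto
      then show "((\<lambda>R. ?s R h) \<longlongrightarrow> 0) at_top"
        by (rule tendsto_eventually)
    qed
    show "\<forall>\<^sub>F R in at_top. AE h in lebesgue. norm (?s R h) \<le> ?s 1 h"
      using eventually_ge_at_top[of 1]
    proof eventually_elim
      case (elim R)
      show ?case
      proof (rule AE_I2)
        fix h :: 'a
        show "norm (?s R h) \<le> ?s 1 h"
          using elim far_kernel_nonneg[of 1 h] by (auto simp: indicator_def)
      qed
    qed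
  qed (use m in auto)
  then have "((\<lambda>R. integral\<^sup>L lebesgue (?s R)) \<longlongrightarrow> 0) at_top" by simp
  then show ?thesis
    by (rule Lim_transform_eventually)
      (use eventually_gt_at_top[of 0] in eventually_elim,
        simp add: measure_levy_measure_far set_lebesgue_integral_def)
qed

text \<open>A monotone kernel is bounded by \<open>j R\<close> outside the ball of radius \<open>R\<close>, so there its power
\<open>q\<close> is at most \<open>j R powr (q - 1)\<close> times the integrable kernel itself.\<close>

lemma integrable_far_powr:
  assumes "0 < R" "1 \<le> q"
  shows "set_integrable lebesgue (- ball (0::'a) R) (\<lambda>h. j (norm h) powr q)"
  unfolding set_integrable_def
proof (rule Bochner_Integration.integrable_bound)
  show "integrable lebesgue (\<lambda>h::'a. j R powr (q - 1) * (indicator (- ball 0 R) h *\<^sub>R j (norm h)))"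
    using integrable_far[OF assms(1)] unfolding set_integrable_def by (rule integrable_mult_right)
  show "(\<lambda>h::'a. indicator (- ball 0 R) h *\<^sub>R j (norm h) powr q) \<in> borel_measurable lebesgue"
    by (rule measurable_completion) measurable
  show "AE h::'a in lebesgue. norm (indicator (- ball 0 R) h *\<^sub>R j (norm h) powr q)
        \<le> norm (j R powr (q - 1) * (indicator (- ball 0 R) h *\<^sub>R j (norm h)))"
  proof (rule AE_I2)
    fix h :: 'a
    show "norm (indicator (- ball 0 R) h *\<^sub>R j (norm h) powr q)
        \<le> norm (j R powr (q - 1) * (indicator (- ball 0 R) h *\<^sub>R j (norm h)))"
    proof (cases "h \<in> - ball 0 R")
      case True
      then have h: "R \<le> norm h" "0 < norm h" using assms by auto
      have "j (norm h) powr q = j (norm h) powr (q - 1) * j (norm h)"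
        using nonneg[OF h(2)] by (cases "j (norm h) = 0") (simp_all add: powr_mult_base mult.commute)
      also have "\<dots> \<le> j R powr (q - 1) * j (norm h)"
        using assms h nonneg[OF h(2)] antimono[OF assms(1) h(1)]
        by (intro mult_right_mono powr_mono2) auto
      finally show ?thesis using True nonneg[OF h(2)] by simp
    qed auto
  qed
qed

text \<open>The kernel is at most \<open>j R\<close> outside the ball, and the translated or reflected function has the
same integral as \<open>\<phi>\<close>.\<close>

lemma far_convolution_L1:
  fixes \<phi> :: "'a \<Rightarrow> real"
  assumes R: "0 < R" and s: "\<bar>s\<bar> = 1" and pos: "\<And>y. 0 \<le> \<phi> y" and \<phi>: "\<phi> \<in> Lp_on 1 UNIV"
  shows "set_integrable lebesgue (- ball 0 R) (\<lambda>h. \<phi> (x + s *\<^sub>R h) * j (norm h))"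
    and "(LINT h:- ball 0 R|lebesgue. \<phi> (x + s *\<^sub>R h) * j (norm h)) \<le> Lp_norm 1 UNIV \<phi> * j R"
proof -
  have \<phi>m: "\<phi> \<in> borel_measurable lebesgue" and \<phi>i: "integrable lebesgue \<phi>"
    using \<phi> pos by (simp_all add: Lp_on_def set_borel_measurable_def set_integrable_def)
  note shift = lebesgue_isometry[OF s \<phi>m, of x]
  note shift(1)[measurable]
  have jR: "0 \<le> j R" by (rule nonneg[OF R])
  have int: "integrable lebesgue (\<lambda>h. \<phi> (x + s *\<^sub>R h) * j R)"
    using shift(2) \<phi>i by (intro integrable_mult_left) simp
  have le: "indicator (- ball 0 R) h *\<^sub>R (\<phi> (x + s *\<^sub>R h) * j (norm h)) \<le> \<phi> (x + s *\<^sub>R h) * j R" for h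
    using pos[of "x + s *\<^sub>R h"] jR antimono[OF R, of "norm h"]
    by (auto simp: indicator_def intro!: mult_left_mono)
  have nn: "0 \<le> indicator (- ball 0 R) h *\<^sub>R (\<phi> (x + s *\<^sub>R h) * j (norm h))" for h
    using mult_nonneg_nonneg[OF pos[of "x + s *\<^sub>R h"] far_kernel_nonneg[OF R, of h]]
    by (simp add: ac_simps)
  have m: "(\<lambda>h. indicator (- ball 0 R) h *\<^sub>R (\<phi> (x + s *\<^sub>R h) * j (norm h))) \<in> borel_measurable lebesgue"
    by (auto intro!: borel_measurable_scaleR borel_measurable_times borel_measurable_indicator)
  have i: "integrable lebesgue (\<lambda>h. indicator (- ball 0 R) h *\<^sub>R (\<phi> (x + s *\<^sub>R h) * j (norm h)))"
    using int m
  proof (rule Bochner_Integration.integrable_bound, intro AE_I2)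
    fix h
    show "norm (indicator (- ball 0 R) h *\<^sub>R (\<phi> (x + s *\<^sub>R h) * j (norm h))) \<le> norm (\<phi> (x + s *\<^sub>R h) * j R)"
      using le[of h] nn[of h] by (simp only: real_norm_def)
  qed
  then show "set_integrable lebesgue (- ball 0 R) (\<lambda>h. \<phi> (x + s *\<^sub>R h) * j (norm h))"
    by (simp add: set_integrable_def)
  have "(LINT h:- ball 0 R|lebesgue. \<phi> (x + s *\<^sub>R h) * j (norm h)) \<le> (LINT h|lebesgue. \<phi> (x + s *\<^sub>R h) * j R)"
    unfolding set_lebesgue_integral_def using i int le by (rule integral_mono)
  also have "\<dots> = (LINT h|lebesgue. \<phi> h) * j R"
    using shift(3) by simp
  also have "\<dots> = Lp_norm 1 UNIV \<phi> * j R"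
    using pos by (simp add: Lp_norm_def set_lebesgue_integral_def integral_nonneg)
  finally show "(LINT h:- ball 0 R|lebesgue. \<phi> (x + s *\<^sub>R h) * j (norm h)) \<le> Lp_norm 1 UNIV \<phi> * j R" .
qed

lemma far_convolution_Lp:
  fixes \<phi> :: "'a \<Rightarrow> real"
  assumes R: "0 < R" and s: "\<bar>s\<bar> = 1" and pos: "\<And>y. 0 \<le> \<phi> y" and \<phi>: "\<phi> \<in> Lp_on p UNIV"
    and pq: "p > 1" "q > 1" "1 / p + 1 / q = 1"
  shows "set_integrable lebesgue (- ball 0 R) (\<lambda>h. \<phi> (x + s *\<^sub>R h) * j (norm h))"
    and "(LINT h:- ball 0 R|lebesgue. \<phi> (x + s *\<^sub>R h) * j (norm h))
       \<le> Lp_norm p UNIV \<phi> * Lp_norm q (- ball 0 R) (\<lambda>h :: 'a. j (norm h))"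
proof -
  have \<phi>m: "\<phi> \<in> borel_measurable lebesgue" and \<phi>i: "integrable lebesgue (\<lambda>h. \<phi> h powr p)"
    using \<phi> pos by (simp_all add: Lp_on_def set_borel_measurable_def set_integrable_def)
  then have \<phi>pm: "(\<lambda>h. \<phi> h powr p) \<in> borel_measurable lebesgue" by auto
  note shift = lebesgue_isometry[OF s \<phi>pm, of x]
  let ?g = "\<lambda>h::'a. indicator (- ball 0 R) h * j (norm h)"
  have g0: "0 \<le> ?g h" for h
    by (rule far_kernel_nonneg[OF R])
  have gq: "?g h powr q = indicator (- ball 0 R) h *\<^sub>R (norm (j (norm h)) powr q)" for h
    using g0[of h] pq by (auto simp: indicator_def)
  have gi: "integrable lebesgue (\<lambda>h. ?g h powr q)"
  proof -
    have "integrable lebesgue (\<lambda>h::'a. indicator (- ball 0 R) h *\<^sub>R (j (norm h) powr q))"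
      using integrable_far_powr[OF R, of q] pq by (simp add: set_integrable_def)
    also have "(\<lambda>h::'a. indicator (- ball 0 R) h *\<^sub>R (j (norm h) powr q)) = (\<lambda>h. ?g h powr q)"
      using g0 pq by (auto simp: indicator_def)
    finally show ?thesis .
  qed
  have gm: "?g \<in> borel_measurable lebesgue"
    by (auto intro!: borel_measurable_times borel_measurable_indicator)
  have i: "integrable lebesgue (\<lambda>h. \<phi> (x + s *\<^sub>R h) * ?g h)"
    and le: "(LINT h|lebesgue. \<phi> (x + s *\<^sub>R h) * ?g h)
      \<le> (LINT h|lebesgue. \<phi> (x + s *\<^sub>R h) powr p) powr (1 / p) * (LINT h|lebesgue. ?g h powr q) powr (1 / q)"
    using Holder_inequality[OF pq lebesgue_isometry(1)[OF s \<phi>m] gm pos g0 _ gi, of x] shift(2) \<phi>i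
    by blast+
  have eq: "\<phi> (x + s *\<^sub>R h) * ?g h = indicator (- ball 0 R) h *\<^sub>R (\<phi> (x + s *\<^sub>R h) * j (norm h))" for h
    by (simp add: ac_simps)
  show "set_integrable lebesgue (- ball 0 R) (\<lambda>h. \<phi> (x + s *\<^sub>R h) * j (norm h))"
    using i unfolding eq set_integrable_def .
  show "(LINT h:- ball 0 R|lebesgue. \<phi> (x + s *\<^sub>R h) * j (norm h))
       \<le> Lp_norm p UNIV \<phi> * Lp_norm q (- ball 0 R) (\<lambda>h :: 'a. j (norm h))"
    using le pos unfolding eq gq shift(3) Lp_norm_def set_lebesgue_integral_def by simp
qed

text \<open>The splitting at radius \<open>R\<close>: inside the ball the quadratic bound on the second difference
produces the truncated second moment, while outside it the triangle inequality gives one term for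
each of \<open>\<phi> (x + h)\<close>, \<open>\<phi> (x - h)\<close> and \<open>2 * \<phi> x\<close>. The first two are bounded by the same number
\<open>N\<close>, which leaves open whether the bound comes from \<open>L\<^sup>1\<close> or from Hoelder.\<close>

lemma second_diff_kernel_bound:
  fixes \<phi> :: "'a \<Rightarrow> real"
  assumes R: "0 < R" and \<phi>m: "\<phi> \<in> borel_measurable lebesgue" and pos: "\<And>y. 0 \<le> \<phi> y"
    and near: "\<And>h. h \<in> ball 0 R \<Longrightarrow> \<bar>second_diff h \<phi> x\<bar> \<le> l * (norm h)\<^sup>2"
    and far: "\<And>s. \<bar>s\<bar> = 1 \<Longrightarrow> set_integrable lebesgue (- ball 0 R) (\<lambda>h. \<phi> (x + s *\<^sub>R h) * j (norm h))"
      "\<And>s. \<bar>s\<bar> = 1 \<Longrightarrow> (LINT h:- ball 0 R|lebesgue. \<phi> (x + s *\<^sub>R h) * j (norm h)) \<le> N"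
  shows "integrable lebesgue (\<lambda>h. second_diff h \<phi> x * j (norm h))"
    and "\<bar>LINT h|lebesgue. second_diff h \<phi> x * j (norm h)\<bar>
       \<le> l * truncated_second_moment TYPE('a) j R + 2 * N + 2 * \<phi> x * measure (levy_measure j) (- ball (0::'a) R)"
proof -
  let ?N = "\<lambda>h::'a. indicator (ball 0 R) h *\<^sub>R ((norm h)\<^sup>2 * j (norm h))"
  let ?F = "\<lambda>s h. indicator (- ball 0 R) h *\<^sub>R (\<phi> (x + s *\<^sub>R h) * j (norm h))"
  let ?T = "\<lambda>h::'a. indicator (- ball 0 R) h *\<^sub>R j (norm h)"
  let ?D = "\<lambda>h. second_diff h \<phi> x * j (norm h)"
  let ?B = "\<lambda>h. l * ?N h + (?F 1 h + ?F (- 1) h) + 2 * \<phi> x * ?T h"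
  note shift = lebesgue_isometry(1)[OF _ \<phi>m, of 1 x] lebesgue_isometry(1)[OF _ \<phi>m, of "-1" x]
  have Dm: "?D \<in> borel_measurable lebesgue"
    unfolding second_diff_def using shift by (auto intro!: borel_measurable_times borel_measurable_add borel_measurable_diff)
  have iN: "integrable lebesgue ?N" using integrable_near[of R] by (simp add: set_integrable_def)
  have iT: "integrable lebesgue ?T" using integrable_far[OF R] by (simp add: set_integrable_def)
  have iF: "integrable lebesgue (?F s)" if "\<bar>s\<bar> = 1" for s
    using far(1)[OF that] by (simp add: set_integrable_def)
  have iB: "integrable lebesgue ?B"
    using iN iT iF[of 1] iF[of "-1"]
    by (intro Bochner_Integration.integrable_add integrable_mult_right) (simp_all only: abs_one abs_minus_cancel)
  \<comment> \<open>At \<open>h = 0\<close> the second difference vanishes, so the uncontrolled value \<open>j 0\<close> does no harm.\<close>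
  have pw: "norm (?D h) \<le> ?B h" for h
  proof (cases "h \<in> ball 0 R")
    case True
    show ?thesis
    proof (cases "h = 0")
      case False
      then have "0 \<le> j (norm h)" by (intro nonneg) simp
      then have "\<bar>second_diff h \<phi> x\<bar> * j (norm h) \<le> l * (norm h)\<^sup>2 * j (norm h)"
        using near[OF True] by (rule mult_right_mono[rotated])
      then show ?thesis using True \<open>0 \<le> j (norm h)\<close> by (simp add: abs_mult ac_simps)
    qed (use R in \<open>simp add: second_diff_def\<close>)
  next
    case False
    then have "0 \<le> j (norm h)" using R by (intro nonneg) auto
    moreover have "\<bar>second_diff h \<phi> x\<bar> \<le> \<phi> (x + h) + \<phi> (x - h) + 2 * \<phi> x"
      using pos[of "x + h"] pos[of "x - h"] pos[of x] by (simp add: second_diff_def)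
    ultimately have "\<bar>second_diff h \<phi> x\<bar> * j (norm h) \<le> (\<phi> (x + h) + \<phi> (x - h) + 2 * \<phi> x) * j (norm h)"
      by (intro mult_right_mono)
    then show ?thesis using False \<open>0 \<le> j (norm h)\<close> by (simp add: abs_mult algebra_simps)
  qed
  show iD: "integrable lebesgue ?D"
    using iB Dm
  proof (rule Bochner_Integration.integrable_bound, intro AE_I2)
    fix h show "norm (?D h) \<le> norm (?B h)" using pw[of h] by (simp only: real_norm_def)
  qed
  have "\<bar>LINT h|lebesgue. ?D h\<bar> \<le> (LINT h|lebesgue. norm (?D h))"
    using integral_norm_bound[of lebesgue ?D] by simp
  also have "\<dots> \<le> (LINT h|lebesgue. ?B h)"
    using iD iB pw by (intro integral_mono) auto
  also have "\<dots> = l * (LINT h|lebesgue. ?N h) + ((LINT h|lebesgue. ?F 1 h) + (LINT h|lebesgue. ?F (- 1) h))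
      + 2 * \<phi> x * (LINT h|lebesgue. ?T h)"
    using iN iT iF[of 1] iF[of "-1"]
    by (simp only: Bochner_Integration.integral_add Bochner_Integration.integrable_add
        integrable_mult_right integral_mult_right_zero abs_one abs_minus_cancel)
  also have "\<dots> \<le> l * truncated_second_moment TYPE('a) j R + (N + N)
      + 2 * \<phi> x * measure (levy_measure j) (- ball (0::'a) R)"
    using far(2)[of 1] far(2)[of "-1"] measure_levy_measure_far[OF R]
    unfolding truncated_second_moment_def set_lebesgue_integral_def by simp
  finally show "\<bar>LINT h|lebesgue. ?D h\<bar>
       \<le> l * truncated_second_moment TYPE('a) j R + 2 * N + 2 * \<phi> x * measure (levy_measure j) (- ball (0::'a) R)"
    by simp
qed

end

section \<open>The potential\<close>

lemma complete_bernstein_levy_density: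
  assumes "complete_bernstein_levy \<Phi> \<mu>"
  shows "levy_density \<mu>"
proof
  have "\<mu> field_differentiable at t \<and> 0 \<le> \<mu> t" if "0 < t" for t
  proof -
    have "\<forall>n. \<forall>t>0. (deriv ^^ n) \<mu> field_differentiable (at t) \<and> 0 \<le> (-1) ^ n * (deriv ^^ n) \<mu> t"
      using assms by (simp add: complete_bernstein_levy_def completely_monotone_def)
    from this[rule_format, of t 0] that show ?thesis by simp
  qed
  then show "continuous_on {0<..} \<mu>" "\<And>t. 0 < t \<Longrightarrow> 0 \<le> \<mu> t"
    by (auto intro!: continuous_at_imp_continuous_on field_differentiable_imp_continuous_at)
  show "set_integrable lebesgue {0<..} (\<lambda>t. min 1 t * \<mu> t)"
    using assms by (simp add: complete_bernstein_levy_def)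
qed

lemma jump_kernel_radial_levy_kernel:
  assumes "levy_density \<mu>"
  shows "radial_levy_kernel (jump_kernel DIM('a) \<mu>) TYPE('a::euclidean_space)"
proof -
  interpret levy_density \<mu> by fact
  show ?thesis
    by unfold_locales
      (use jump_kernel_nonneg jump_kernel_antimono nn_integral_min_square_jump_kernel_finite in \<open>auto simp: levy_moment_def\<close>)
qed

context radial_levy_kernel
begin

text \<open>The formula for \<open>V\<close> is assumed only where the singular integral converges absolutely; the
splitting shows that it does at such a point \<open>x\<close>. Division by \<open>2 * \<phi> x\<close> gives the three terms.\<close>

lemma potential_bound:
  fixes \<phi> V :: "'a \<Rightarrow> real"
  assumes R: "0 < R" and \<phi>m: "\<phi> \<in> borel_measurable lebesgue" and pos: "\<And>y. 0 < \<phi> y"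
    and V: "pointwise_potential j V \<phi>"
    and near: "\<And>h. h \<in> ball 0 R \<Longrightarrow> \<bar>second_diff h \<phi> x\<bar> \<le> l * (norm h)\<^sup>2"
    and far: "\<And>s. \<bar>s\<bar> = 1 \<Longrightarrow> set_integrable lebesgue (- ball 0 R) (\<lambda>h. \<phi> (x + s *\<^sub>R h) * j (norm h))"
      "\<And>s. \<bar>s\<bar> = 1 \<Longrightarrow> (LINT h:- ball 0 R|lebesgue. \<phi> (x + s *\<^sub>R h) * j (norm h)) \<le> N"
  shows "\<bar>V x\<bar> \<le> 1 / 2 * (l / \<phi> x) * truncated_second_moment TYPE('a) j R + N / \<phi> x
      + measure (levy_measure j) (- ball (0::'a) R)"
proof -
  note D = second_diff_kernel_bound[OF R \<phi>m less_imp_le[OF pos] near far]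
  let ?b = "l * truncated_second_moment TYPE('a) j R + 2 * N + 2 * \<phi> x * measure (levy_measure j) (- ball (0::'a) R)"
  have "V x = 1 / (2 * \<phi> x) * (LINT h|lebesgue. second_diff h \<phi> x * j (norm h))"
    using V D(1) by (simp add: pointwise_potential_def)
  then have "\<bar>V x\<bar> = \<bar>LINT h|lebesgue. second_diff h \<phi> x * j (norm h)\<bar> / (2 * \<phi> x)"
    using pos[of x] by (simp add: abs_mult)
  also have "\<dots> \<le> ?b / (2 * \<phi> x)"
    using D(2) pos[of x] by (intro divide_right_mono) auto
  also have "\<dots> = 1 / 2 * (l / \<phi> x) * truncated_second_moment TYPE('a) j R + N / \<phi> x
      + measure (levy_measure j) (- ball (0::'a) R)"
    using pos[of x] by (simp add: field_simps)
  finally show ?thesis .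
qed

text \<open>The last term of the bound tends to zero unconditionally, because a Levy measure has vanishing mass
far from the origin.\<close>

lemma potential_tendsto_0:
  fixes V L \<phi> b :: "'a \<Rightarrow> real"
  assumes C: "0 < C"
    and bound: "\<And>x. x \<in> - ball 0 M \<Longrightarrow>
      \<bar>V x\<bar> \<le> 1 / 2 * (L x / \<phi> x) * truncated_second_moment TYPE('a) j (C * norm x) + N * (b x / \<phi> x)
           + measure (levy_measure j) (- ball (0::'a) (C * norm x))"
    and near: "((\<lambda>x. L x * truncated_second_moment TYPE('a) j (C * norm x) / \<phi> x) \<longlongrightarrow> 0) at_infinity"
    and far: "((\<lambda>x. b x / \<phi> x) \<longlongrightarrow> 0) at_infinity"
  shows "(V \<longlongrightarrow> 0) at_infinity"
proof (rule Lim_null_comparison)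
  let ?u = "\<lambda>x. 1 / 2 * (L x * truncated_second_moment TYPE('a) j (C * norm x) / \<phi> x) + N * (b x / \<phi> x)
      + measure (levy_measure j) (- ball (0::'a) (C * norm x))"
  have "filterlim (\<lambda>x::'a. C * norm x) at_top at_infinity"
    using C by (intro filterlim_tendsto_pos_mult_at_top[OF tendsto_const] filterlim_norm_at_top)
  then have "((\<lambda>x::'a. measure (levy_measure j) (- ball (0::'a) (C * norm x))) \<longlongrightarrow> 0) at_infinity"
    by (rule filterlim_compose[OF levy_measure_far_tendsto_0])
  then have "(?u \<longlongrightarrow> 1 / 2 * 0 + N * 0 + 0) at_infinity"
    by (intro tendsto_add tendsto_mult near far tendsto_const)
  then show "(?u \<longlongrightarrow> 0) at_infinity" by simp
  show "\<forall>\<^sub>F x in at_infinity. norm (V x) \<le> ?u x"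
    unfolding eventually_at_infinity
    by (intro exI[of _ M] allI impI) (use bound in auto)
qed

end

theorem theorem4p2:
  fixes \<Phi> \<mu> j :: "real \<Rightarrow> real"
    and V \<phi> L :: "real ^ 'd \<Rightarrow> real"
    and C M p q :: real
  assumes "complete_bernstein_levy \<Phi> \<mu>"
    and "j = jump_kernel CARD('d) \<mu>"
    and "\<phi> \<in> Lp_on 2 UNIV" and "\<phi> \<in> Linfty_on UNIV" and "\<forall>x. \<phi> x > 0"
    and "zero_eigenfunction \<Phi> V \<phi>" and "pointwise_potential j V \<phi>"
    and "0 < C" and "C < 1" and "p \<ge> 1"
    and "p > 1 \<longrightarrow> 1 / p + 1 / q = 1"
    and "\<phi> \<in> Z_space C" and "\<phi> \<in> Lp_on p UNIV"
    and "Z_bound C \<phi> M L"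
  shows "(p = 1 \<longrightarrow> (\<forall>x\<in>- ball 0 M.
            \<bar>V x\<bar> \<le> 1 / 2 * (L x / \<phi> x) * truncated_second_moment TYPE(real ^ 'd) j (C * norm x)
                    + Lp_norm 1 UNIV \<phi> * (j (C * norm x) / \<phi> x)
                    + measure (levy_measure j :: (real ^ 'd) measure) (- ball 0 (C * norm x))))
       \<and> (p > 1 \<longrightarrow> (\<forall>x\<in>- ball 0 M.
            \<bar>V x\<bar> \<le> 1 / 2 * (L x / \<phi> x) * truncated_second_moment TYPE(real ^ 'd) j (C * norm x)
                    + Lp_norm p UNIV \<phi>
                      * (Lp_norm q (- ball 0 (C * norm x)) (\<lambda>h :: real ^ 'd. j (norm h)) / \<phi> x)
                    + measure (levy_measure j :: (real ^ 'd) measure) (- ball 0 (C * norm x))))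
       \<and> (p = 1
          \<and> ((\<lambda>x. L x * truncated_second_moment TYPE(real ^ 'd) j (C * norm x) / \<phi> x) \<longlongrightarrow> 0) at_infinity
          \<and> ((\<lambda>x. j (C * norm x) / \<phi> x) \<longlongrightarrow> 0) at_infinity
          \<longrightarrow> (V \<longlongrightarrow> 0) at_infinity)
       \<and> (p > 1
          \<and> ((\<lambda>x. L x * truncated_second_moment TYPE(real ^ 'd) j (C * norm x) / \<phi> x) \<longlongrightarrow> 0) at_infinity
          \<and> ((\<lambda>x. Lp_norm q (- ball 0 (C * norm x)) (\<lambda>h :: real ^ 'd. j (norm h)) / \<phi> x) \<longlongrightarrow> 0) at_infinity
          \<longrightarrow> (V \<longlongrightarrow> 0) at_infinity)"
proof -
  have "radial_levy_kernel j TYPE(real ^ 'd)"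
    using jump_kernel_radial_levy_kernel[OF complete_bernstein_levy_density[OF assms(1)], where 'a = "real ^ 'd"]
    by (simp add: assms(2))
  then interpret radial_levy_kernel j "TYPE(real ^ 'd)" .
  have \<phi>m: "\<phi> \<in> borel_measurable lebesgue"
    using assms(13) by (simp add: Lp_on_def set_borel_measurable_def)
  have pos: "\<And>y. 0 < \<phi> y" using assms(5) by simp
  note nonneg\<phi> = less_imp_le[OF pos]
  have R: "0 < C * norm x" if "x \<in> - ball 0 M" for x :: "real ^ 'd"
  proof -
    have "0 < M" using assms(14) by (simp add: Z_bound_def)
    then have "0 < norm x" using that by auto
    then show ?thesis using assms(8) by simp
  qed
  have near: "\<bar>second_diff h \<phi> x\<bar> \<le> L x * (norm h)\<^sup>2"
    if "x \<in> - ball 0 M" "h \<in> ball 0 (C * norm x)" for x h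
    using assms(14) that by (simp add: Z_bound_def)
  have bound1: "\<bar>V x\<bar> \<le> 1 / 2 * (L x / \<phi> x) * truncated_second_moment TYPE(real ^ 'd) j (C * norm x)
                    + Lp_norm 1 UNIV \<phi> * (j (C * norm x) / \<phi> x)
                    + measure (levy_measure j :: (real ^ 'd) measure) (- ball 0 (C * norm x))"
    if p: "p = 1" and x: "x \<in> - ball 0 M" for x
  proof -
    have \<phi>1: "\<phi> \<in> Lp_on 1 UNIV" using assms(13) p by simp
    show ?thesis
      using potential_bound[OF R[OF x] \<phi>m pos assms(7) near[OF x]
          far_convolution_L1[OF R[OF x] _ nonneg\<phi> \<phi>1, of _ x]]
      by simp
  qed
  have bound2: "\<bar>V x\<bar> \<le> 1 / 2 * (L x / \<phi> x) * truncated_second_moment TYPE(real ^ 'd) j (C * norm x)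
                    + Lp_norm p UNIV \<phi>
                      * (Lp_norm q (- ball 0 (C * norm x)) (\<lambda>h :: real ^ 'd. j (norm h)) / \<phi> x)
                    + measure (levy_measure j :: (real ^ 'd) measure) (- ball 0 (C * norm x))"
    if p: "p > 1" and x: "x \<in> - ball 0 M" for x
  proof -
    have pq: "1 / p + 1 / q = 1" using assms(11) p by simp
    moreover have "0 < 1 / p" "1 / p < 1" using p by simp_all
    ultimately have "0 < 1 / q" "1 / q < 1" by linarith+
    then have q: "q > 1" by (simp add: divide_less_eq split: if_splits)
    show ?thesis
      using potential_bound[OF R[OF x] \<phi>m pos assms(7) near[OF x]
          far_convolution_Lp[OF R[OF x] _ nonneg\<phi> assms(13) p q pq, of _ x]]
      by simp
  qed
  show ?thesis
    using bound1 bound2 potential_tendsto_0[OF assms(8) bound1] potential_tendsto_0[OF assms(8) bound2]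
    by blast
qed

end
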